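(* Let $\ell$ be an odd prime, let $\sigma=\frac{\ell}{2}\,(\ell E_2(q^\ell)-E_2(q))$, and let $U=U(X,Y,Z)$ be the Charlap-Coley-Robbins polynomial for $\ell$ written in terms of $E_4,E_6$, so that $U(\sigma,E_4,E_6)=0$. Put $\tilde E_4=E_4(q^\ell)$, and let $\partial_\sigma,\partial_4,\partial_6$ denote the partial derivatives of $U$ with respect to its first, second and third variable, evaluated at $(\sigma,E_4,E_6)$. Then $$\tilde E_4=-\,\frac{4\ell\,(3E_4^2\,\partial_6+2E_6\,\partial_4)-\partial_\sigma\,(\ell^2E_4+4\sigma^2)}{\ell^4\,\partial_\sigma}.$$
   Context: Here $q=\exp(2i\pi\tau)$, and $E_2(q)=1-24\sum_{n\ge1}\delta_1(n)q^n$, $E_4(q)=1+240\sum_{n\ge1}\delta_3(n)q^n$, $E_6(q)=1-504\sum_{n\ge1}\delta_5(n)q^n$, where $\delta_r(n)$ is the sum of the $r$-th powers of the divisors of $n$. We abbreviate $E_k=E_k(q)$ and $\tilde E_k=E_k(q^\ell)$. The Charlap-Coley-Robbins (CCR) polynomial $U_\ell(X,A,B)\in\mathbb{Z}[X,A,B,1/\ell]$ is the polynomial, monic of degree $\ell+1$ in $X$, with $U_\ell(\sigma,A,B)=0$ for $A=-3E_4$, $B=-2E_6$ (it is the minimal polynomial of $\sigma$ over $\mathbb{Q}(E_4,E_6)$). We write $U(X,Y,Z)=U_\ell(X,-3Y,-2Z)$, so that $U(\sigma,E_4,E_6)=0$. Assigning weights $1,2,3$ to $X,Y,Z$, the polynomial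 $U$ is weighted homogeneous of degree $\ell+1$. The identity is one of (quotients of) power series in $q$; $\partial_\sigma$ is a nonzero series since $U$ is the minimal polynomial of $\sigma$. *)

theory Defs
  imports "HOL-Computational_Algebra.Computational_Algebra"
begin

text \<open>
  All identities are identities of formal \<open>q\<close>-expansions with rational coefficients. Quotients
  are taken in the field \<^typ>\<open>rat fls\<close> of formal Laurent series, with \<open>q\<close> the formal variable.
\<close>

definition divisor_sigma :: "nat \<Rightarrow> nat \<Rightarrow> nat" where
  "divisor_sigma r n = (\<Sum>d | d dvd n. d ^ r)"

definition Eis2 :: "rat fps" where
  "Eis2 = Abs_fps (\<lambda>n. if n = 0 then 1 else - 24 * of_nat (divisor_sigma 1 n))"

definition Eis4 :: "rat fps" where
  "Eis4 = Abs_fps (\<lambda>n. if n = 0 then 1 else 240 * of_nat (divisor_sigma 3 n))"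

definition Eis6 :: "rat fps" where
  "Eis6 = Abs_fps (\<lambda>n. if n = 0 then 1 else - 504 * of_nat (divisor_sigma 5 n))"

definition E2 :: "rat fls" where "E2 = fps_to_fls Eis2"
definition E4 :: "rat fls" where "E4 = fps_to_fls Eis4"
definition E6 :: "rat fls" where "E6 = fps_to_fls Eis6"

text \<open>The series obtained by substituting \<open>q\<^sup>l\<close> for \<open>q\<close> (used for \<open>l > 0\<close> only).\<close>

definition E2_tilde :: "nat \<Rightarrow> rat fls" where
  "E2_tilde l = fps_to_fls (fps_compose Eis2 (fps_X ^ l))"

definition E4_tilde :: "nat \<Rightarrow> rat fls" where
  "E4_tilde l = fps_to_fls (fps_compose Eis4 (fps_X ^ l))"

definition ccr_sigma :: "nat \<Rightarrow> rat fls" where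
  "ccr_sigma l = of_nat l / 2 * (of_nat l * E2_tilde l - E2)"

text \<open>
  A polynomial in three variables is a \<^typ>\<open>rat poly poly poly\<close>: the outermost variable is the
  first one (\<open>X\<close>), the innermost is the third. So \<open>coeff3 P i j k\<close> is the coefficient of
  \<open>X\<^sup>i Y\<^sup>j Z\<^sup>k\<close>, and \<^const>\<open>degree\<close> and \<^const>\<open>lead_coeff\<close> refer to \<open>X\<close>.
\<close>

type_synonym poly3 = "rat poly poly poly"

definition coeff3 :: "poly3 \<Rightarrow> nat \<Rightarrow> nat \<Rightarrow> nat \<Rightarrow> rat" where
  "coeff3 P i j k = coeff (coeff (coeff P i) j) k"

definition eval1 :: "rat fls \<Rightarrow> rat poly \<Rightarrow> rat fls" where
  "eval1 z p = poly (map_poly fls_const p) z"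

definition eval2 :: "rat fls \<Rightarrow> rat fls \<Rightarrow> rat poly poly \<Rightarrow> rat fls" where
  "eval2 y z p = poly (map_poly (eval1 z) p) y"

definition eval3 :: "rat fls \<Rightarrow> rat fls \<Rightarrow> rat fls \<Rightarrow> poly3 \<Rightarrow> rat fls" where
  "eval3 x y z P = poly (map_poly (eval2 y z) P) x"

definition partial1 :: "poly3 \<Rightarrow> poly3" where
  "partial1 P = pderiv P"

definition partial2 :: "poly3 \<Rightarrow> poly3" where
  "partial2 P = map_poly pderiv P"

definition partial3 :: "poly3 \<Rightarrow> poly3" where
  "partial3 P = map_poly (map_poly pderiv) P"

definition weighted_homogeneous :: "nat \<Rightarrow> nat \<Rightarrow> nat \<Rightarrow> nat \<Rightarrow> poly3 \<Rightarrow> bool" where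
  "weighted_homogeneous w1 w2 w3 d P \<longleftrightarrow>
     (\<forall>i j k. coeff3 P i j k \<noteq> 0 \<longrightarrow> w1 * i + w2 * j + w3 * k = d)"

definition is_subfield :: "'a::field set \<Rightarrow> bool" where
  "is_subfield K \<longleftrightarrow> 0 \<in> K \<and> 1 \<in> K \<and>
     (\<forall>x\<in>K. \<forall>y\<in>K. x + y \<in> K \<and> x * y \<in> K) \<and> (\<forall>x\<in>K. - x \<in> K \<and> inverse x \<in> K)"

text \<open>In characteristic 0 the prime field is the rationals, so \<open>generated_field S\<close> is \<open>\<rat>(S)\<close>.\<close>

definition generated_field :: "'a::field set \<Rightarrow> 'a set" where
  "generated_field S = \<Inter>{K. is_subfield K \<and> S \<subseteq> K}"

definition is_minimal_poly :: "'a::field set \<Rightarrow> 'a \<Rightarrow> 'a poly \<Rightarrow> bool" where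
  "is_minimal_poly K x p \<longleftrightarrow>
     lead_coeff p = 1 \<and> (\<forall>i. coeff p i \<in> K) \<and> poly p x = 0 \<and>
     (\<forall>r. r \<noteq> 0 \<and> (\<forall>i. coeff r i \<in> K) \<and> poly r x = 0 \<longrightarrow> degree p \<le> degree r)"

text \<open>
  The Charlap-Coley-Robbins polynomial \<open>U\<^sub>l(X, A, B)\<close>, the variables being in this order: it has
  coefficients in \<open>\<int>[1/l]\<close>, is monic of degree \<open>l + 1\<close> in \<open>X\<close> and weighted homogeneous for the
  weights 1, 2, 3, and its specialization at \<open>A = -3 E\<^sub>4\<close>, \<open>B = -2 E\<^sub>6\<close> is the minimal polynomial
  of \<open>\<sigma>\<close> over \<open>\<rat>(E\<^sub>4, E\<^sub>6)\<close>.
\<close>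

definition is_CCR_polynomial :: "nat \<Rightarrow> poly3 \<Rightarrow> bool" where
  "is_CCR_polynomial l P \<longleftrightarrow>
     (\<forall>i j k. \<exists>(m::int) n. coeff3 P i j k = of_int m / of_nat l ^ n) \<and>
     lead_coeff P = 1 \<and> degree P = l + 1 \<and>
     eval3 (ccr_sigma l) (- 3 * E4) (- 2 * E6) P = 0 \<and>
     is_minimal_poly (generated_field {E4, E6}) (ccr_sigma l)
       (map_poly (eval2 (- 3 * E4) (- 2 * E6)) P) \<and>
     weighted_homogeneous 1 2 3 (l + 1) P"

text \<open>The substitution \<open>P(X, -3Y, -2Z)\<close>.\<close>

definition ccr_subst :: "poly3 \<Rightarrow> poly3" where
  "ccr_subst P =
     map_poly (\<lambda>c. pcompose (map_poly (\<lambda>b. pcompose b [:0, - 2:]) c) [:0, - 3:]) P"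

end

(*
  Differentiating U(\<sigma>, E4, E6) = 0 by \<theta> = q d/dq and eliminating E2 with Euler's relation for the
  weighted homogeneous U gives the formula, once \<theta>E2, \<theta>E4 and \<theta>E6 are known from Ramanujan's
  differential equations. These are equivalent to convolution identities for divisor sums, obtained
  by Skoruppa's argument: if g(a,b) = g(b,a) and g(a,a+b) = g(b,a+b), then the shear
  (a, x, b, y) \<mapsto> (a, x - y, a + b, y) shows that g(a,a+b) - g(a,b), summed over all positive solutions
  of ax + by = n, reduces to the degenerate solutions a = b and x = y, that is, to divisor sums.
  Such g are the polynomials in a^2 - ab + b^2 and a^2 b^2 (a-b)^2. That \<partial>\<sigma> does not vanish
  is separability of a minimal polynomial in characteristic 0.
*)
theory Submission
  imports Defs
begin

section \<open>Convolutions of divisor sums as sums over ax + by = n\<close>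

text \<open>The cofactors \<open>x\<close>, \<open>y\<close> are recorded beside the divisors
  \<open>a\<close>, \<open>b\<close> because the bijections used below act on all four
  entries.\<close>

definition splittings :: "nat \<Rightarrow> (nat \<times> nat \<times> nat \<times> nat) set" where
  "splittings n = {(a, x, b, y). 0 < a \<and> 0 < x \<and> 0 < b \<and> 0 < y \<and> a * x + b * y = n}"

lemma finite_splittings: "finite (splittings n)"
proof (rule finite_subset)
  show "splittings n \<subseteq> {..n} \<times> {..n} \<times> {..n} \<times> {..n}"
  proof
    fix t assume "t \<in> splittings n"
    then obtain a x b y where t: "t = (a, x, b, y)"
      and pos: "0 < a" "0 < x" "0 < b" "0 < y" and eq: "a * x + b * y = n"
      by (auto simp: splittings_def)
    have "a * 1 \<le> a * x" "1 * x \<le> a * x" "b * 1 \<le> b * y" "1 * y \<le> b * y"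
      using pos by (intro mult_le_mono; simp)+
    with eq have "a \<le> n" "x \<le> n" "b \<le> n" "y \<le> n" by linarith+
    with t show "t \<in> {..n} \<times> {..n} \<times> {..n} \<times> {..n}" by simp
  qed
qed auto

text \<open>Every natural number divides 0, so the sum runs over an infinite set and has the default
  value 0. Hence the end terms of a convolution vanish.\<close>

lemma divisor_sigma_0 [simp]: "divisor_sigma r 0 = 0"
  by (simp add: divisor_sigma_def)

text \<open>A divisor \<open>a\<close> of \<open>k\<close> and a divisor \<open>b\<close> of
  \<open>n - k\<close> determine their cofactors \<open>x\<close> and \<open>y\<close>; conversely
  \<open>k\<close> is recovered as \<open>a * x\<close>.\<close>

lemma sum_divisor_sigma_mult:
  "(\<Sum>k\<le>n. divisor_sigma r k * divisor_sigma s (n - k))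
    = (\<Sum>(a, x, b, y)\<in>splittings n. a ^ r * b ^ s)"
proof -
  have pos: "0 < b" "0 < m div b" if "b dvd m" "0 < m" for b m :: nat
    using that by (auto elim!: dvdE)
  have "(\<Sum>k\<le>n. divisor_sigma r k * divisor_sigma s (n - k))
      = (\<Sum>k\<in>{0<..<n}. divisor_sigma r k * divisor_sigma s (n - k))"
    by (rule sum.mono_neutral_right) (auto simp: not_less)
  also have "\<dots> = (\<Sum>k\<in>{0<..<n}. \<Sum>(a, b)\<in>{a. a dvd k} \<times> {b. b dvd n - k}. a ^ r * b ^ s)"
    by (simp add: divisor_sigma_def sum_product sum.cartesian_product)
  also have "\<dots> = (\<Sum>(k, a, b)\<in>(SIGMA k:{0<..<n}. {a. a dvd k} \<times> {b. b dvd n - k}). a ^ r * b ^ s)"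
    by (subst sum.Sigma) (auto simp: case_prod_unfold)
  also have "\<dots> = (\<Sum>(a, x, b, y)\<in>splittings n. a ^ r * b ^ s)"
    by (rule sum.reindex_bij_witness[where i = "\<lambda>(a, x, b, y). (a * x, a, b)"
          and j = "\<lambda>(k, a, b). (a, k div a, b, (n - k) div b)"])
       (auto simp: splittings_def, (metis pos zero_less_diff)+)
  finally show ?thesis .
qed

lemma sum_splittings_swap:
  "(\<Sum>(a, x, b, y)\<in>{(a, x, b, y)\<in>splittings n. P a x b y}. f a x b y)
    = (\<Sum>(a, x, b, y)\<in>{(a, x, b, y)\<in>splittings n. P b y a x}. f b y a x)"
  by (rule sum.reindex_bij_witness[where i = "\<lambda>(a, x, b, y). (b, y, a, x)"
        and j = "\<lambda>(a, x, b, y). (b, y, a, x)"]) (auto simp: splittings_def add.commute)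

text \<open>Trichotomy. The compared quantities are arbitrary functions because the reduction below
  compares \<open>y\<close> with \<open>x\<close> in one sum and \<open>a\<close> with
  \<open>b\<close> in another.\<close>

lemma sum_splittings_split:
  fixes f :: "nat \<Rightarrow> nat \<Rightarrow> nat \<Rightarrow> nat \<Rightarrow> 'a::comm_monoid_add"
    and u v :: "nat \<Rightarrow> nat \<Rightarrow> nat \<Rightarrow> nat \<Rightarrow> nat"
  shows "(\<Sum>(a, x, b, y)\<in>splittings n. f a x b y)
    = (\<Sum>(a, x, b, y)\<in>{(a, x, b, y)\<in>splittings n. u a x b y < v a x b y}. f a x b y)
    + (\<Sum>(a, x, b, y)\<in>{(a, x, b, y)\<in>splittings n. v a x b y < u a x b y}. f a x b y)
    + (\<Sum>(a, x, b, y)\<in>{(a, x, b, y)\<in>splittings n. u a x b y = v a x b y}. f a x b y)"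
  (is "_ = sum ?f ?L + sum ?f ?G + sum ?f ?E")
proof -
  have fin: "finite ?L" "finite ?G" "finite ?E"
    by (auto intro: finite_subset[OF _ finite_splittings])
  have "splittings n = (?L \<union> ?G) \<union> ?E" by auto
  then have "sum ?f (splittings n) = sum ?f ((?L \<union> ?G) \<union> ?E)" by (rule arg_cong)
  also have "\<dots> = sum ?f (?L \<union> ?G) + sum ?f ?E"
    by (rule sum.union_disjoint) (use fin in auto)
  also have "sum ?f (?L \<union> ?G) = sum ?f ?L + sum ?f ?G"
    by (rule sum.union_disjoint) (use fin in auto)
  finally show ?thesis .
qed

text \<open>If a = b = d, the equation reads d(x + y) = n: thus d divides n, and x may be any of 1,
  ..., n/d - 1.\<close>

lemma sum_splittings_diag_values:
  fixes g :: "nat \<Rightarrow> 'a::comm_ring_1"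
  shows "(\<Sum>(a, x, b, y)\<in>{(a, x, b, y)\<in>splittings n. a = b}. g a)
    = (\<Sum>d | d dvd n. of_nat (n div d - 1) * g d)"
proof (cases "n = 0")
  case True
  then have "splittings n = {}" by (auto simp: splittings_def)
  with True show ?thesis by (simp add: case_prod_unfold)
next
  case False
  then have "(\<Sum>(d, x)\<in>(SIGMA d:{d. d dvd n}. {0<..<n div d}). g d)
      = (\<Sum>(a, x, b, y)\<in>{(a, x, b, y)\<in>splittings n. a = b}. g a)"
    by (intro sum.reindex_bij_witness[where i = "\<lambda>(a, x, b, y). (a, x)"
          and j = "\<lambda>(d, x). (d, x, d, n div d - x)"])
       (auto simp: splittings_def elim!: dvdE simp flip: add_mult_distrib2)
  moreover have "(\<Sum>(d, x)\<in>(SIGMA d:{d. d dvd n}. {0<..<n div d}). g d)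
      = (\<Sum>d | d dvd n. of_nat (n div d - 1) * g d)"
    using False by (subst sum.Sigma[symmetric]) auto
  ultimately show ?thesis by simp
qed

text \<open>If x = y, then d = a + b satisfies dx = n, and a may be any of 1, ..., d - 1. For n = 0
  the right-hand side is a sum over infinitely many d, which is 0 by convention.\<close>

lemma sum_splittings_diag_multipliers:
  fixes g :: "nat \<Rightarrow> nat \<Rightarrow> 'a::comm_ring_1"
  shows "(\<Sum>(a, x, b, y)\<in>{(a, x, b, y)\<in>splittings n. y = x}. g a (a + b))
    = (\<Sum>d | d dvd n. \<Sum>a\<in>{0<..<d}. g a d)"
proof (cases "n = 0")
  case True
  then have "splittings n = {}" by (auto simp: splittings_def)
  with True show ?thesis by (simp add: case_prod_unfold)
next
  case False
  then have "(\<Sum>(d, a)\<in>(SIGMA d:{d. d dvd n}. {0<..<d}). g a d)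
      = (\<Sum>(a, x, b, y)\<in>{(a, x, b, y)\<in>splittings n. y = x}. g a (a + b))"
    by (intro sum.reindex_bij_witness[where i = "\<lambda>(a, x, b, y). (a + b, a)"
          and j = "\<lambda>(d, a). (a, n div d, d - a, n div d)"])
       (auto simp: splittings_def elim!: dvdE simp flip: add_mult_distrib)
  moreover have "(\<Sum>(d, a)\<in>(SIGMA d:{d. d dvd n}. {0<..<d}). g a d)
      = (\<Sum>d | d dvd n. \<Sum>a\<in>{0<..<d}. g a d)"
    using False by (subst sum.Sigma[symmetric]) auto
  ultimately show ?thesis by simp
qed

text \<open>The sum of g(a,a+b) is split by comparing y with x, that of g(a,b) by comparing a with
  b. All four off-diagonal parts equal the sum of g(a,b) over a < b, so they cancel and only the two
  diagonals remain.\<close>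

lemma sum_splittings_symmetric:
  fixes g :: "nat \<Rightarrow> nat \<Rightarrow> 'a::comm_ring_1"
  assumes sym: "\<And>a b. g a b = g b a"
    and flip: "\<And>a b. g a (a + b) = g b (a + b)"
  shows "(\<Sum>(a, x, b, y)\<in>splittings n. g a (a + b) - g a b)
    = (\<Sum>d | d dvd n. (\<Sum>a\<in>{0<..<d}. g a d) - of_nat (n div d - 1) * g d d)"
proof -
  have shear1: "a * (x + y) + (b - a) * y = a * x + b * y" if "a < b" for a b x y :: nat
    using less_imp_add_positive[OF that] by (auto simp: algebra_simps)
  have shear2: "a * (x - y) + (a + b) * y = a * x + b * y" if "y < x" for a b x y :: nat
    using less_imp_add_positive[OF that] by (auto simp: algebra_simps)
  \<comment> \<open>Subtracting y from x and adding a to b preserves ax + by; the new second value a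
    + b exceeds a, and the condition y < x keeps the new multiplier positive.\<close>
  have shear: "(\<Sum>(a, x, b, y)\<in>{(a, x, b, y)\<in>splittings n. y < x}. g a (a + b))
      = (\<Sum>(a, x, b, y)\<in>{(a, x, b, y)\<in>splittings n. a < b}. g a b)"
    by (rule sum.reindex_bij_witness[where i = "\<lambda>(a, x, b, y). (a, x + y, b - a, y)"
          and j = "\<lambda>(a, x, b, y). (a, x - y, a + b, y)"])
       (auto simp: splittings_def shear1 shear2)
  \<comment> \<open>Exchanging (a, x) with (b, y) turns x < y into y < x, and \<open>flip\<close>
    restores the first argument of g.\<close>
  have swap1: "(\<Sum>(a, x, b, y)\<in>{(a, x, b, y)\<in>splittings n. x < y}. g a (a + b))
      = (\<Sum>(a, x, b, y)\<in>{(a, x, b, y)\<in>splittings n. y < x}. g a (a + b))"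
  proof (subst sum_splittings_swap, rule sum.cong, safe)
    fix a b show "g b (b + a) = g a (a + b)" using flip[of b a] by (simp only: add.commute)
  qed
  have swap2: "(\<Sum>(a, x, b, y)\<in>{(a, x, b, y)\<in>splittings n. b < a}. g a b)
      = (\<Sum>(a, x, b, y)\<in>{(a, x, b, y)\<in>splittings n. a < b}. g a b)"
    by (subst sum_splittings_swap) (simp add: sym)
  have diag: "(\<Sum>(a, x, b, y)\<in>{(a, x, b, y)\<in>splittings n. a = b}. g a b)
      = (\<Sum>(a, x, b, y)\<in>{(a, x, b, y)\<in>splittings n. a = b}. g a a)"
    by (rule sum.cong) auto
  have "(\<Sum>(a, x, b, y)\<in>splittings n. g a (a + b) - g a b)
      = (\<Sum>(a, x, b, y)\<in>splittings n. g a (a + b)) - (\<Sum>(a, x, b, y)\<in>splittings n. g a b)"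
    by (simp add: sum_subtractf case_prod_unfold)
  also have "\<dots> = (\<Sum>(a, x, b, y)\<in>{(a, x, b, y)\<in>splittings n. y = x}. g a (a + b))
      - (\<Sum>(a, x, b, y)\<in>{(a, x, b, y)\<in>splittings n. a = b}. g a b)"
    unfolding sum_splittings_split[of "\<lambda>a x b y. g a (a + b)" n "\<lambda>a x b y. y" "\<lambda>a x b y. x"]
      sum_splittings_split[of "\<lambda>a x b y. g a b" n "\<lambda>a x b y. a" "\<lambda>a x b y. b"]
    by (simp only: shear swap1 swap2 add_diff_cancel_left)
  also have "\<dots> = (\<Sum>d | d dvd n. (\<Sum>a\<in>{0<..<d}. g a d) - of_nat (n div d - 1) * g d d)"
    by (simp only: diag sum_splittings_diag_values sum_splittings_diag_multipliers
        sum_subtractf)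
  finally show ?thesis .
qed

section \<open>Convolution identities for the divisor-sum series\<close>

definition sigma_series :: "nat \<Rightarrow> rat fps" where
  "sigma_series r = Abs_fps (\<lambda>n. of_nat (divisor_sigma r n))"

definition theta :: "'a::comm_ring_1 fps \<Rightarrow> 'a fps" where
  "theta f = fps_X * fps_deriv f"

lemma theta_nth: "theta f $ n = of_nat n * f $ n"
  by (cases n) (simp_all add: theta_def)

lemma sigma_series_nth: "sigma_series r $ n = (\<Sum>d | d dvd n. of_nat d ^ r)"
  by (simp add: sigma_series_def divisor_sigma_def)

lemma sigma_series_nth_0 [simp]: "sigma_series r $ 0 = 0"
  by (simp add: sigma_series_def)

lemma sigma_series_mult_nth:
  "(sigma_series r * sigma_series s) $ n = (\<Sum>(a, x, b, y)\<in>splittings n. of_nat a ^ r * of_nat b ^ s)"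
proof -
  have "(sigma_series r * sigma_series s) $ n
      = of_nat (\<Sum>k\<le>n. divisor_sigma r k * divisor_sigma s (n - k))"
    by (simp add: fps_mult_nth sigma_series_def atLeast0AtMost)
  also have "\<dots> = (\<Sum>(a, x, b, y)\<in>splittings n. of_nat a ^ r * of_nat b ^ s)"
    unfolding sum_divisor_sigma_mult by (simp add: case_prod_unfold)
  finally show ?thesis .
qed

text \<open>Packages the reduction so that each convolution identity needs only polynomial checks
  over the rationals: \<open>closed\<close> compares the contribution of a single divisor d with the
  summand p(n,d) of the claimed right-hand side.\<close>

lemma fps_eq_of_symmetric_function:
  fixes g p :: "rat \<Rightarrow> rat \<Rightarrow> rat" and F G :: "rat fps"
  assumes sym: "\<And>a b. g a b = g b a"
    and flip: "\<And>a b. g a (a + b) = g b (a + b)"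
    and F: "\<And>n. F $ n
      = (\<Sum>(a, x, b, y)\<in>splittings n. g (of_nat a) (of_nat a + of_nat b) - g (of_nat a) (of_nat b))"
    and G: "\<And>n. G $ n = (\<Sum>d | d dvd n. p (of_nat n) (of_nat d))"
    and closed: "\<And>n e d. e = of_nat d \<Longrightarrow> e \<noteq> 0 \<Longrightarrow>
      (\<Sum>a<d. g (of_nat a) e) - g 0 e - (n / e - 1) * g e e = p n e"
  shows "F = G"
proof (rule fps_ext)
  fix n
  show "F $ n = G $ n"
  proof (cases "n = 0")
    case True
    moreover have "splittings 0 = {}" by (auto simp: splittings_def)
    ultimately show ?thesis by (simp add: F G)
  next
    case False
    have "F $ n = (\<Sum>(a, x, b, y)\<in>splittings n.
        g (of_nat a) (of_nat (a + b)) - g (of_nat a) (of_nat b))"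
      by (simp add: F)
    also have "\<dots> = (\<Sum>d | d dvd n. (\<Sum>a\<in>{0<..<d}. g (of_nat a) (of_nat d))
        - of_nat (n div d - 1) * g (of_nat d) (of_nat d))"
      by (rule sum_splittings_symmetric) (simp_all only: of_nat_add, (rule sym flip)+)
    also have "\<dots> = (\<Sum>d | d dvd n. p (of_nat n) (of_nat d))"
    proof (rule sum.cong)
      fix d assume "d \<in> {d. d dvd n}"
      then have d: "0 < d" "d dvd n" using False by (auto intro: dvd_pos_nat)
      then obtain k where k: "n = d * k" by (elim dvdE)
      \<comment> \<open>The power-sum formulas start at a = 0, the reduction at a = 1; this accounts
        for the term \<open>g 0 e\<close> in \<open>closed\<close>.\<close>
      have "{..<d} = insert 0 {0<..<d}" using d by auto
      then have "(\<Sum>a<d. g (of_nat a) (of_nat d))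
          = g 0 (of_nat d) + (\<Sum>a\<in>{0<..<d}. g (of_nat a) (of_nat d))" by simp
      \<comment> \<open>As n > 0, the quotient is at least 1 and the truncated subtraction is
        exact.\<close>
      moreover have "(of_nat (n div d - 1) :: rat) = of_nat n / of_nat d - 1"
        using k False by (simp add: Suc_le_eq)
      ultimately show "(\<Sum>a\<in>{0<..<d}. g (of_nat a) (of_nat d))
          - of_nat (n div d - 1) * g (of_nat d) (of_nat d) = p (of_nat n) (of_nat d)"
        using closed[of "of_nat d" d "of_nat n"] d by simp
    qed simp
    finally show ?thesis by (simp add: G)
  qed
qed

text \<open>Faulhaber's formulas up to exponent 6, the largest degree of a function g below. The
  inductions run on versions with cleared denominators, where the step is a polynomial
  identity.\<close>

lemma sum_powers_lessThan:
  fixes d :: nat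
  defines "e \<equiv> of_nat d :: rat"
  shows "(\<Sum>a<d. of_nat a) = (e^2 - e) / 2"
    and "(\<Sum>a<d. of_nat a ^ 2) = (2*e^3 - 3*e^2 + e) / 6"
    and "(\<Sum>a<d. of_nat a ^ 3) = (e^4 - 2*e^3 + e^2) / 4"
    and "(\<Sum>a<d. of_nat a ^ 4) = (6*e^5 - 15*e^4 + 10*e^3 - e) / 30"
    and "(\<Sum>a<d. of_nat a ^ 5) = (2*e^6 - 6*e^5 + 5*e^4 - e^2) / 12"
    and "(\<Sum>a<d. of_nat a ^ 6) = (6*e^7 - 21*e^6 + 21*e^5 - 7*e^3 + e) / 42"
proof -
  have "2 * (\<Sum>a<d. of_nat a) = e^2 - e"
    unfolding e_def
  proof (induction d)
    case (Suc d)
    show ?case by (simp only: sum.lessThan_Suc of_nat_Suc distrib_left Suc.IH) algebra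
  qed simp
  then show "(\<Sum>a<d. of_nat a) = (e^2 - e) / 2" by simp
  have "6 * (\<Sum>a<d. of_nat a ^ 2) = 2*e^3 - 3*e^2 + e"
    unfolding e_def
  proof (induction d)
    case (Suc d)
    show ?case by (simp only: sum.lessThan_Suc of_nat_Suc distrib_left Suc.IH) algebra
  qed simp
  then show "(\<Sum>a<d. of_nat a ^ 2) = (2*e^3 - 3*e^2 + e) / 6" by simp
  have "4 * (\<Sum>a<d. of_nat a ^ 3) = e^4 - 2*e^3 + e^2"
    unfolding e_def
  proof (induction d)
    case (Suc d)
    show ?case by (simp only: sum.lessThan_Suc of_nat_Suc distrib_left Suc.IH) algebra
  qed simp
  then show "(\<Sum>a<d. of_nat a ^ 3) = (e^4 - 2*e^3 + e^2) / 4" by simp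
  have "30 * (\<Sum>a<d. of_nat a ^ 4) = 6*e^5 - 15*e^4 + 10*e^3 - e"
    unfolding e_def
  proof (induction d)
    case (Suc d)
    show ?case by (simp only: sum.lessThan_Suc of_nat_Suc distrib_left Suc.IH) algebra
  qed simp
  then show "(\<Sum>a<d. of_nat a ^ 4) = (6*e^5 - 15*e^4 + 10*e^3 - e) / 30" by simp
  have "12 * (\<Sum>a<d. of_nat a ^ 5) = 2*e^6 - 6*e^5 + 5*e^4 - e^2"
    unfolding e_def
  proof (induction d)
    case (Suc d)
    show ?case by (simp only: sum.lessThan_Suc of_nat_Suc distrib_left Suc.IH) algebra
  qed simp
  then show "(\<Sum>a<d. of_nat a ^ 5) = (2*e^6 - 6*e^5 + 5*e^4 - e^2) / 12" by simp
  have "42 * (\<Sum>a<d. of_nat a ^ 6) = 6*e^7 - 21*e^6 + 21*e^5 - 7*e^3 + e"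
    unfolding e_def
  proof (induction d)
    case (Suc d)
    show ?case by (simp only: sum.lessThan_Suc of_nat_Suc distrib_left Suc.IH) algebra
  qed simp
  then show "(\<Sum>a<d. of_nat a ^ 6) = (6*e^7 - 21*e^6 + 21*e^5 - 7*e^3 + e) / 42" by simp
qed

text \<open>The form a^2 - ab + b^2 grows by 2ab when b is replaced by a + b. The factor 6 clears
  the denominators of the power sums, and the term n d in \<open>p\<close> produces
  \<open>theta (sigma_series 1)\<close>.\<close>

lemma sigma_series_1_1:
  "12 * (sigma_series 1 * sigma_series 1)
    = 5 * sigma_series 3 + sigma_series 1 - 6 * theta (sigma_series 1)"
proof -
  define g :: "rat \<Rightarrow> rat \<Rightarrow> rat" where
    "g a b = 6 * (a^2 - a*b + b^2)" for a b
  define p :: "rat \<Rightarrow> rat \<Rightarrow> rat" where "p n d = 5 * d^3 + d - 6 * n * d" for n d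
  have diff: "g a (a + b) - g a b = 12 * (a ^ 1 * b ^ 1)" for a b
    unfolding g_def by algebra
  show ?thesis
  proof (rule fps_eq_of_symmetric_function[where g = g and p = p])
    fix n e :: rat and d :: nat assume e: "e = of_nat d" "e \<noteq> 0"
    have "g a e = 6*a^2 - 6*e*a + 6*e^2" for a
      unfolding g_def by algebra
    then have "(\<Sum>a<d. g (of_nat a) e)
        = 6*(\<Sum>a<d. of_nat a ^ 2) - 6*e*(\<Sum>a<d. of_nat a) + 6 * (e * e ^ 2)"
      by (simp add: sum.distrib sum_subtractf sum_distrib_left mult.assoc e(1))
    then show "(\<Sum>a<d. g (of_nat a) e) - g 0 e - (n / e - 1) * g e e = p n e"
      unfolding sum_powers_lessThan e(1)[symmetric] using e(2)
      by (simp add: g_def p_def field_simps eval_nat_numeral)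
  next
    show "g a b = g b a" "g a (a + b) = g b (a + b)" for a b
      unfolding g_def by algebra+
  qed (simp only: diff numeral_fps_const fps_add_nth fps_mult_left_const_nth sigma_series_mult_nth
        case_prod_unfold sum_distrib_left sum.distrib,
      simp add: p_def numeral_fps_const theta_nth sigma_series_nth sum.distrib sum_subtractf
        sum_distrib_left algebra_simps)
qed

text \<open>Squaring the form works since (a^2 + ab + b^2)^2 - (a^2 - ab + b^2)^2 = 4ab(a^2 + b^2).
  Both orders of the product are kept to match its two monomials.\<close>

lemma sigma_series_1_3:
  "120 * (sigma_series 1 * sigma_series 3) + 120 * (sigma_series 3 * sigma_series 1)
    = 21 * sigma_series 5 + 10 * sigma_series 3 - sigma_series 1
      - 30 * theta (sigma_series 3)"
proof -
  define g :: "rat \<Rightarrow> rat \<Rightarrow> rat" where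
    "g a b = 30 * (a^2 - a*b + b^2)^2" for a b
  define p :: "rat \<Rightarrow> rat \<Rightarrow> rat" where "p n d = 21 * d^5 + 10 * d^3 - d - 30 * n * d^3" for n d
  have diff: "g a (a + b) - g a b = 120 * (a ^ 1 * b ^ 3) + 120 * (a ^ 3 * b ^ 1)" for a b
    unfolding g_def by algebra
  show ?thesis
  proof (rule fps_eq_of_symmetric_function[where g = g and p = p])
    fix n e :: rat and d :: nat assume e: "e = of_nat d" "e \<noteq> 0"
    have "g a e = 30*a^4 - 60*e*a^3 + 90*e^2*a^2 - 60*e^3*a + 30*e^4" for a
      unfolding g_def by algebra
    then have "(\<Sum>a<d. g (of_nat a) e)
        = 30*(\<Sum>a<d. of_nat a ^ 4) - 60*e*(\<Sum>a<d. of_nat a ^ 3)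
          + 90*e^2*(\<Sum>a<d. of_nat a ^ 2) - 60*e^3*(\<Sum>a<d. of_nat a) + 30 * (e * e^4)"
      by (simp add: sum.distrib sum_subtractf sum_distrib_left mult.assoc e(1))
    then show "(\<Sum>a<d. g (of_nat a) e) - g 0 e - (n / e - 1) * g e e = p n e"
      unfolding sum_powers_lessThan e(1)[symmetric] using e(2)
      by (simp add: g_def p_def field_simps eval_nat_numeral)
  next
    show "g a b = g b a" "g a (a + b) = g b (a + b)" for a b
      unfolding g_def by algebra+
  qed (simp only: diff numeral_fps_const fps_add_nth fps_mult_left_const_nth sigma_series_mult_nth
        case_prod_unfold sum_distrib_left sum.distrib,
      simp add: p_def numeral_fps_const theta_nth sigma_series_nth sum.distrib sum_subtractf
        sum_distrib_left algebra_simps)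
qed

text \<open>Equivalent to E_4^2 = E_8 = 1 + 480 \<open>sigma_series 7\<close>. Here g(d,d) = 0, so
  no \<open>theta\<close> term arises.\<close>

lemma sigma_series_3_3:
  "120 * (sigma_series 3 * sigma_series 3)
    = sigma_series 7 - sigma_series 3"
proof -
  define g :: "rat \<Rightarrow> rat \<Rightarrow> rat" where
    "g a b = 30 * (a^2 * b^2 * (a - b)^2)" for a b
  define p :: "rat \<Rightarrow> rat \<Rightarrow> rat" where "p n d = d^7 - d^3" for n d
  have diff: "g a (a + b) - g a b = 120 * (a ^ 3 * b ^ 3)" for a b
    unfolding g_def by algebra
  show ?thesis
  proof (rule fps_eq_of_symmetric_function[where g = g and p = p])
    fix n e :: rat and d :: nat assume e: "e = of_nat d" "e \<noteq> 0"
    have "g a e = 30*e^2*a^4 - 60*e^3*a^3 + 30*e^4*a^2" for a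
      unfolding g_def by algebra
    then have "(\<Sum>a<d. g (of_nat a) e)
        = 30*e^2*(\<Sum>a<d. of_nat a ^ 4) - 60*e^3*(\<Sum>a<d. of_nat a ^ 3)
          + 30*e^4*(\<Sum>a<d. of_nat a ^ 2)"
      by (simp add: sum.distrib sum_subtractf sum_distrib_left mult.assoc e(1))
    then show "(\<Sum>a<d. g (of_nat a) e) - g 0 e - (n / e - 1) * g e e = p n e"
      unfolding sum_powers_lessThan e(1)[symmetric] using e(2)
      by (simp add: g_def p_def field_simps eval_nat_numeral)
  next
    show "g a b = g b a" "g a (a + b) = g b (a + b)" for a b
      unfolding g_def by algebra+
  qed (simp only: diff numeral_fps_const fps_add_nth fps_mult_left_const_nth sigma_series_mult_nth
        case_prod_unfold sum_distrib_left sum.distrib,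
      simp add: p_def numeral_fps_const theta_nth sigma_series_nth sum.distrib sum_subtractf
        sum_distrib_left algebra_simps)
qed

text \<open>The multiple of \<open>a\<^sup>2 b\<^sup>2 (a - b)\<^sup>2\<close> in \<open>g\<close> is chosen to cancel the terms \<open>a\<^sup>3 b\<^sup>3\<close>.\<close>
lemma sigma_series_1_5:
  "252 * (sigma_series 1 * sigma_series 5) + 252 * (sigma_series 5 * sigma_series 1)
    = 20 * sigma_series 7 + 21 * sigma_series 5 + sigma_series 1
      - 42 * theta (sigma_series 5)"
proof -
  define g :: "rat \<Rightarrow> rat \<Rightarrow> rat" where
    "g a b = 42 * (a^2 - a*b + b^2)^3 - 147 * (a^2 * b^2 * (a - b)^2)" for a b
  define p :: "rat \<Rightarrow> rat \<Rightarrow> rat" where "p n d = 20 * d^7 + 21 * d^5 + d - 42 * n * d^5" for n d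
  have diff: "g a (a + b) - g a b = 252 * (a ^ 1 * b ^ 5) + 252 * (a ^ 5 * b ^ 1)" for a b
    unfolding g_def by algebra
  show ?thesis
  proof (rule fps_eq_of_symmetric_function[where g = g and p = p])
    fix n e :: rat and d :: nat assume e: "e = of_nat d" "e \<noteq> 0"
    have "g a e = 42*a^6 - 126*e*a^5 + 105*e^2*a^4 + 105*e^4*a^2 - 126*e^5*a + 42*e^6" for a
      unfolding g_def by algebra
    then have "(\<Sum>a<d. g (of_nat a) e)
        = 42*(\<Sum>a<d. of_nat a ^ 6) - 126*e*(\<Sum>a<d. of_nat a ^ 5)
          + 105*e^2*(\<Sum>a<d. of_nat a ^ 4) + 105*e^4*(\<Sum>a<d. of_nat a ^ 2)
          - 126*e^5*(\<Sum>a<d. of_nat a) + 42 * (e * e^6)"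
      by (simp add: sum.distrib sum_subtractf sum_distrib_left mult.assoc e(1))
    then show "(\<Sum>a<d. g (of_nat a) e) - g 0 e - (n / e - 1) * g e e = p n e"
      unfolding sum_powers_lessThan e(1)[symmetric] using e(2)
      by (simp add: g_def p_def field_simps eval_nat_numeral)
  next
    show "g a b = g b a" "g a (a + b) = g b (a + b)" for a b
      unfolding g_def by algebra+
  qed (simp only: diff numeral_fps_const fps_add_nth fps_mult_left_const_nth sigma_series_mult_nth
        case_prod_unfold sum_distrib_left sum.distrib,
      simp add: p_def numeral_fps_const theta_nth sigma_series_nth sum.distrib sum_subtractf
        sum_distrib_left algebra_simps)
qed

section \<open>Ramanujan's differential equations\<close>

lemma Eis2_eq: "Eis2 = 1 - 24 * sigma_series 1"
  and Eis4_eq: "Eis4 = 1 + 240 * sigma_series 3"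
  and Eis6_eq: "Eis6 = 1 - 504 * sigma_series 5"
  by (auto simp: Eis2_def Eis4_def Eis6_def sigma_series_def fps_eq_iff numeral_fps_const)

lemma theta_add: "theta (f + g) = theta f + theta g"
  and theta_diff: "theta (f - g) = theta f - theta g"
  and theta_numeral_mult: "theta (numeral k * f) = numeral k * theta f"
  and theta_1 [simp]: "theta 1 = 0"
  by (simp_all add: theta_def algebra_simps numeral_fps_const)


text \<open>After expansion in divisor-sum series this is 48 times \<open>sigma_series_1_1\<close>;
  the equation for \<open>Eis4\<close> is likewise 24 times \<open>sigma_series_1_3\<close>.\<close>

lemma ramanujan_E2: "12 * theta Eis2 = Eis2\<^sup>2 - Eis4"
  using sigma_series_1_1 unfolding Eis2_eq Eis4_eq theta_diff theta_numeral_mult theta_1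
  by algebra

lemma ramanujan_E4: "3 * theta Eis4 = Eis2 * Eis4 - Eis6"
  using sigma_series_1_3 unfolding Eis2_eq Eis4_eq Eis6_eq theta_add theta_numeral_mult theta_1
  by algebra

text \<open>The square of \<open>Eis4\<close> brings in the square of \<open>sigma_series 3\<close>,
  which \<open>sigma_series_3_3\<close> rewrites by \<open>sigma_series 7\<close>; this cancels the
  \<open>sigma_series 7\<close> of \<open>sigma_series_1_5\<close>.\<close>

lemma ramanujan_E6: "2 * theta Eis6 = Eis2 * Eis6 - Eis4\<^sup>2"
  using sigma_series_1_5 sigma_series_3_3
  unfolding Eis2_eq Eis4_eq Eis6_eq theta_diff theta_numeral_mult theta_1
  by algebra

section \<open>Evaluation of polynomials in three variables\<close>

text \<open>The coefficient map is general because evaluation is nested: \<open>fls_const\<close>,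
  \<open>eval1 z\<close> and \<open>eval2 y z\<close> in turn serve as \<open>f\<close>.\<close>

lemma poly_map_poly_add:
  assumes "f 0 = (0 :: 'b::comm_ring_1)" and "\<And>a b. f (a + b) = f a + f b"
  shows "poly (map_poly f (p + q)) x = poly (map_poly f p) x + poly (map_poly f q) x"
  by (induction p q rule: poly_induct2) (simp_all add: map_poly_pCons assms algebra_simps)

lemma poly_map_poly_mult:
  fixes p q :: "'a::comm_ring_1 poly" and f :: "'a \<Rightarrow> 'b::comm_ring_1"
  assumes "f 0 = 0" and "\<And>a b. f (a + b) = f a + f b" and "\<And>a b. f (a * b) = f a * f b"
  shows "poly (map_poly f (p * q)) x = poly (map_poly f p) x * poly (map_poly f q) x"
proof (induction p)
  case (pCons a p)
  have smult: "poly (map_poly f (smult a q)) x = f a * poly (map_poly f q) x"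
    by (induction q) (simp_all add: map_poly_pCons assms algebra_simps)
  have "poly (map_poly f (pCons a p * q)) x
      = poly (map_poly f (smult a q)) x + poly (map_poly f (pCons 0 (p * q))) x"
    by (simp add: poly_map_poly_add assms)
  then show ?case
    using pCons.IH smult by (simp add: map_poly_pCons assms algebra_simps)
qed simp

lemma eval1_0 [simp]: "eval1 z 0 = 0"
  by (simp add: eval1_def)

lemma eval1_pCons [simp]: "eval1 z (pCons a p) = fls_const a + z * eval1 z p"
  by (simp add: eval1_def map_poly_pCons)

lemma eval1_add: "eval1 z (p + q) = eval1 z p + eval1 z q"
  by (simp add: eval1_def poly_map_poly_add fls_plus_const)

lemma eval1_smult: "eval1 z (smult c p) = fls_const c * eval1 z p"
  by (induction p) (simp_all add: algebra_simps flip: fls_const_mult_const)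

lemma eval1_mult: "eval1 z (p * q) = eval1 z p * eval1 z q"
  by (simp add: eval1_def poly_map_poly_mult fls_plus_const)

lemma eval2_0 [simp]: "eval2 y z 0 = 0"
  by (simp add: eval2_def)

lemma eval2_pCons [simp]: "eval2 y z (pCons a p) = eval1 z a + y * eval2 y z p"
  by (simp add: eval2_def map_poly_pCons)

lemma eval2_add: "eval2 y z (p + q) = eval2 y z p + eval2 y z q"
  by (simp add: eval2_def poly_map_poly_add eval1_add)

lemma eval2_mult: "eval2 y z (p * q) = eval2 y z p * eval2 y z q"
  by (simp add: eval2_def poly_map_poly_mult eval1_add eval1_mult)

lemma eval2_of_nat_mult: "eval2 y z (of_nat n * p) = of_nat n * eval2 y z p"
  by (induction n) (simp_all add: eval2_add algebra_simps)

lemma eval3_0 [simp]: "eval3 x y z 0 = 0"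
  by (simp add: eval3_def)

lemma eval3_pCons [simp]: "eval3 x y z (pCons a p) = eval2 y z a + x * eval3 x y z p"
  by (simp add: eval3_def map_poly_pCons)

lemma eval3_add: "eval3 x y z (p + q) = eval3 x y z p + eval3 x y z q"
  by (simp add: eval3_def poly_map_poly_add eval2_add)

section \<open>Chain rule and Euler's relation\<close>

lemma eval1_chain: "fls_deriv (eval1 z p) = eval1 z (pderiv p) * fls_deriv z"
  by (induction p) (simp_all add: pderiv_pCons eval1_add algebra_simps)

lemma eval2_chain:
  "fls_deriv (eval2 y z p)
    = eval2 y z (pderiv p) * fls_deriv y + eval2 y z (map_poly pderiv p) * fls_deriv z"
  by (induction p) (simp_all add: pderiv_pCons map_poly_pCons eval2_add eval1_chain algebra_simps)

lemma eval3_chain: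
  "fls_deriv (eval3 x y z P) = eval3 x y z (partial1 P) * fls_deriv x
    + eval3 x y z (partial2 P) * fls_deriv y + eval3 x y z (partial3 P) * fls_deriv z"
  by (induction P)
    (simp_all add: partial1_def partial2_def partial3_def pderiv_pCons map_poly_pCons eval3_add
      eval2_chain algebra_simps)

text \<open>Removing one power of the variable lowers the degree by its weight. The degree
  \<open>d\<close> is an integer so that it may become negative in the induction; the remaining
  polynomial is then 0.\<close>

lemma eval1_euler:
  assumes "\<And>k. coeff p k \<noteq> 0 \<Longrightarrow> int w * int k = d"
  shows "of_nat w * z * eval1 z (pderiv p) = of_int d * eval1 z p"
  using assms
proof (induction p arbitrary: d)
  case (pCons a p)
  have "of_nat w * z * eval1 z (pderiv p) = of_int (d - int w) * eval1 z p"
  proof (rule pCons.IH)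
    fix k assume "coeff p k \<noteq> 0"
    then show "int w * int k = d - int w"
      using pCons.prems[of "Suc k"] by (simp add: algebra_simps)
  qed
  \<comment> \<open>A nonzero constant term forces d = 0.\<close>
  moreover have "of_int d * fls_const a = 0"
    using pCons.prems[of 0] by (cases "a = 0") auto
  ultimately show ?case
    by (simp only: pderiv_pCons eval1_add eval1_pCons fls_const_0 of_int_diff of_int_of_nat_eq)
      algebra
qed simp

text \<open>The coefficient \<open>a\<close> is constant in y and homogeneous of degree d in z, so
  the one-variable relation covers it; the rest has degree d - v.\<close>

lemma eval2_euler:
  assumes "\<And>j k. coeff (coeff p j) k \<noteq> 0 \<Longrightarrow> int v * int j + int w * int k = d"
  shows "of_nat v * y * eval2 y z (pderiv p) + of_nat w * z * eval2 y z (map_poly pderiv p)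
    = of_int d * eval2 y z p"
  using assms
proof (induction p arbitrary: d)
  case (pCons a p)
  have "of_nat v * y * eval2 y z (pderiv p) + of_nat w * z * eval2 y z (map_poly pderiv p)
      = of_int (d - int v) * eval2 y z p"
  proof (rule pCons.IH)
    fix j k assume "coeff (coeff p j) k \<noteq> 0"
    then show "int v * int j + int w * int k = d - int v"
      using pCons.prems[of "Suc j" k] by (simp add: algebra_simps)
  qed
  moreover have "of_nat w * z * eval1 z (pderiv a) = of_int d * eval1 z a"
    by (rule eval1_euler) (use pCons.prems[of 0] in simp)
  ultimately show ?case
    by (simp add: pderiv_pCons map_poly_pCons eval2_add) algebra
qed simp

lemma eval3_euler:
  assumes "\<And>i j k. coeff3 P i j k \<noteq> 0 \<Longrightarrow> int u * int i + int v * int j + int w * int k = d"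
  shows "of_nat u * x * eval3 x y z (partial1 P) + of_nat v * y * eval3 x y z (partial2 P)
      + of_nat w * z * eval3 x y z (partial3 P)
    = of_int d * eval3 x y z P"
  using assms
proof (induction P arbitrary: d)
  case (pCons a P)
  have "of_nat u * x * eval3 x y z (partial1 P) + of_nat v * y * eval3 x y z (partial2 P)
      + of_nat w * z * eval3 x y z (partial3 P)
      = of_int (d - int u) * eval3 x y z P"
  proof (rule pCons.IH)
    fix i j k assume "coeff3 P i j k \<noteq> 0"
    then show "int u * int i + int v * int j + int w * int k = d - int u"
      using pCons.prems[of "Suc i" j k] by (simp add: coeff3_def algebra_simps)
  qed
  moreover have "of_nat v * y * eval2 y z (pderiv a) + of_nat w * z * eval2 y z (map_poly pderiv a)
      = of_int d * eval2 y z a"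
    by (rule eval2_euler) (use pCons.prems[of 0] in \<open>simp add: coeff3_def\<close>)
  ultimately show ?case
    by (simp add: partial1_def partial2_def partial3_def pderiv_pCons map_poly_pCons eval3_add)
      algebra
qed (simp add: partial1_def partial2_def partial3_def)

lemma eval3_euler_weighted_homogeneous:
  assumes "weighted_homogeneous u v w d P"
  shows "of_nat u * x * eval3 x y z (partial1 P) + of_nat v * y * eval3 x y z (partial2 P)
      + of_nat w * z * eval3 x y z (partial3 P)
    = of_nat d * eval3 x y z P"
proof -
  have "int u * int i + int v * int j + int w * int k = int d" if "coeff3 P i j k \<noteq> 0" for i j k
    using assms that unfolding weighted_homogeneous_def by (metis of_nat_add of_nat_mult)
  from eval3_euler[OF this] show ?thesis by simp
qed

section \<open>The substitution relating the two forms of the polynomial\<close>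

lemma eval1_pcompose_linear: "eval1 z (pcompose b [:0, c:]) = eval1 (fls_const c * z) b"
  by (induction b) (simp_all add: pcompose_pCons eval1_add eval1_mult eval1_smult algebra_simps)

lemma eval2_subst:
  "eval2 y z (pcompose (map_poly (\<lambda>b. pcompose b [:0, - 2:]) c) [:0, - 3:])
    = eval2 (- 3 * y) (- 2 * z) c"
proof (induction c)
  case (pCons a c)
  have "[:0, - 3:] * p = pCons 0 ([:- 3:] * p)" for p :: "rat poly poly"
    by simp
  moreover have "eval1 z (- 3) = - 3"
    by (simp add: numeral_poly)
  ultimately show ?case
    using pCons by (simp only: map_poly_pCons pcompose_pCons pcompose_0 eval2_add eval2_pCons
        eval2_mult eval2_0 eval1_0 eval1_pcompose_linear) (simp add: algebra_simps)
qed simp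

text \<open>Specializing the last two variables gives the same polynomial in X on both sides, so
  vanishing at \<sigma> and minimality carry over to U.\<close>

lemma map_poly_eval2_ccr_subst:
  "map_poly (eval2 y z) (ccr_subst P) = map_poly (eval2 (- 3 * y) (- 2 * z)) P"
  by (intro poly_eqI) (simp add: ccr_subst_def coeff_map_poly eval2_subst)

text \<open>Turns the first partial derivative into an ordinary derivative over the Laurent series,
  to which the separability argument applies.\<close>

lemma eval3_partial1: "eval3 x y z (partial1 P) = poly (pderiv (map_poly (eval2 y z) P)) x"
proof -
  have "map_poly (eval2 y z) (pderiv P) = pderiv (map_poly (eval2 y z) P)"
    by (intro poly_eqI) (simp add: coeff_map_poly coeff_pderiv eval2_of_nat_mult del: of_nat_Suc)
  then show ?thesis by (simp add: eval3_def partial1_def)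
qed

lemma coeff3_ccr_subst: "coeff3 (ccr_subst P) i j k = (- 3) ^ j * (- 2) ^ k * coeff3 P i j k"
proof -
  \<comment> \<open>The second variable is scaled by a constant polynomial in the third, so
    \<open>- 3\<close> must first be recognized as such.\<close>
  have "(- 3 :: rat poly) = [:- 3:]" by (simp add: numeral_poly)
  then have "(- 3) ^ j * p = [:(- 3) ^ j:] * p" for p :: "rat poly"
    by (simp only: poly_const_pow)
  then have "(- 3) ^ j * p = smult ((- 3) ^ j) p" for p :: "rat poly"
    by simp
  then show ?thesis
    by (simp add: coeff3_def ccr_subst_def coeff_map_poly coeff_pcompose_linear)
qed

lemma weighted_homogeneous_ccr_subst:
  "weighted_homogeneous u v w d P \<Longrightarrow> weighted_homogeneous u v w d (ccr_subst P)"
  by (simp add: weighted_homogeneous_def coeff3_ccr_subst)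

section \<open>Separability of the minimal polynomial\<close>

lemma is_subfield_generated_field: "is_subfield (generated_field S)"
  unfolding is_subfield_def generated_field_def by blast

text \<open>In characteristic 0 the derivative is a nonzero polynomial over K of smaller degree; if
  it vanished at x, it would contradict minimality.\<close>

lemma minimal_poly_pderiv_nonzero:
  fixes K :: "'a::field_char_0 set"
  assumes K: "is_subfield K" and p: "is_minimal_poly K x p"
  shows "poly (pderiv p) x \<noteq> 0"
proof
  assume root: "poly (pderiv p) x = 0"
  have "of_nat n \<in> K" for n
    using K by (induction n) (auto simp: is_subfield_def)
  then have coeffs: "\<forall>i. coeff (pderiv p) i \<in> K"
    using K p by (auto simp: coeff_pderiv is_subfield_def is_minimal_poly_def simp del: of_nat_Suc)
  \<comment> \<open>A monic constant is 1 and has no root.\<close>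
  have "degree p \<noteq> 0"
  proof
    assume "degree p = 0"
    then obtain c where "p = [:c:]" by (rule degree_eq_zeroE)
    then show False using p by (auto simp: is_minimal_poly_def)
  qed
  then have "pderiv p \<noteq> 0" and "degree (pderiv p) < degree p"
    by (simp_all add: pderiv_eq_0_iff degree_pderiv)
  with root coeffs p show False
    unfolding is_minimal_poly_def by (meson not_less)
qed

section \<open>Differentiation after replacing q by q^l\<close>

text \<open>The chain rule: q d/dq multiplies q^l by l.\<close>

lemma theta_compose_power:
  fixes f :: "'a::idom fps"
  assumes "0 < l"
  shows "theta (fps_compose f (fps_X ^ l)) = of_nat l * fps_compose (theta f) (fps_X ^ l)"
proof -
  have X0: "(fps_X ^ l :: 'a fps) $ 0 = 0" using assms by simp
  have "fps_X * fps_deriv (fps_X ^ l :: 'a fps) = of_nat l * fps_X ^ l"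
    unfolding theta_def[symmetric]
    by (rule fps_ext) (simp add: theta_nth flip: fps_of_nat)
  moreover have "theta (fps_compose f (fps_X ^ l))
      = fps_compose (fps_deriv f) (fps_X ^ l) * (fps_X * fps_deriv (fps_X ^ l))"
    by (simp add: theta_def fps_compose_deriv[OF X0] algebra_simps)
  moreover have "fps_compose (theta f) (fps_X ^ l)
      = fps_X ^ l * fps_compose (fps_deriv f) (fps_X ^ l)"
    by (simp add: theta_def fps_compose_mult_distrib[OF X0] fps_X_fps_compose_startby0[OF X0])
  ultimately show ?thesis by simp
qed

lemma theta_fps_to_fls: "fls_X * fls_deriv (fps_to_fls f) = fps_to_fls (theta f)"
  by (simp add: theta_def fls_deriv_fps_to_fls fls_times_fps_to_fls)

lemma ramanujan_E2_tilde:
  assumes "0 < l"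
  shows "12 * theta (fps_compose Eis2 (fps_X ^ l))
    = of_nat l * ((fps_compose Eis2 (fps_X ^ l))\<^sup>2 - fps_compose Eis4 (fps_X ^ l))"
proof -
  have X0: "(fps_X ^ l :: rat fps) $ 0 = 0" using assms by simp
  have "fps_compose (12 * theta Eis2) (fps_X ^ l) = 12 * fps_compose (theta Eis2) (fps_X ^ l)"
    by (simp add: fps_compose_mult_distrib[OF X0] numeral_fps_const)
  then show ?thesis
    using assms by (simp add: theta_compose_power ramanujan_E2 fps_compose_sub_distrib
        fps_compose_power[OF X0])
qed

lemma theta_E2_tilde:
  assumes "0 < l"
  shows "12 * (fls_X * fls_deriv (E2_tilde l)) = of_nat l * ((E2_tilde l)\<^sup>2 - E4_tilde l)"
  using arg_cong[OF ramanujan_E2_tilde[OF assms], of fps_to_fls]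
  by (simp add: E2_tilde_def E4_tilde_def theta_fps_to_fls fls_times_fps_to_fls fps_to_fls_power)

lemma theta_E2: "12 * (fls_X * fls_deriv E2) = E2\<^sup>2 - E4"
  using arg_cong[OF ramanujan_E2, of fps_to_fls]
  by (simp add: E2_def E4_def theta_fps_to_fls fls_times_fps_to_fls fps_to_fls_power)

lemma theta_E4: "3 * (fls_X * fls_deriv E4) = E2 * E4 - E6"
  using arg_cong[OF ramanujan_E4, of fps_to_fls]
  by (simp add: E2_def E4_def E6_def theta_fps_to_fls fls_times_fps_to_fls)

lemma theta_E6: "2 * (fls_X * fls_deriv E6) = E2 * E6 - E4\<^sup>2"
  using arg_cong[OF ramanujan_E6, of fps_to_fls]
  by (simp add: E2_def E4_def E6_def theta_fps_to_fls fls_times_fps_to_fls fps_to_fls_power)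

section \<open>Elimination of E_2\<close>

theorem proposition4p1:
  fixes l :: nat and CCR U :: poly3 and \<sigma> d\<sigma> d4 d6 :: "rat fls"
  assumes "prime l" and "odd l"
    and "is_CCR_polynomial l CCR"
    and "U = ccr_subst CCR"
    and "\<sigma> = ccr_sigma l"
    and "d\<sigma> = eval3 \<sigma> E4 E6 (partial1 U)"
    and "d4 = eval3 \<sigma> E4 E6 (partial2 U)"
    and "d6 = eval3 \<sigma> E4 E6 (partial3 U)"
  shows "d\<sigma> \<noteq> 0 \<and>
    E4_tilde l =
      - ((4 * of_nat l * (3 * E4\<^sup>2 * d6 + 2 * E6 * d4) - d\<sigma> * ((of_nat l)\<^sup>2 * E4 + 4 * \<sigma>\<^sup>2))
         / ((of_nat l) ^ 4 * d\<sigma>))"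
proof -
  have l: "0 < l" using assms(1) by (simp add: prime_gt_0_nat)
  define L :: "rat fls" where "L = of_nat l"
  have L0: "L \<noteq> 0" using l by (simp add: L_def)
  define T where "T f = fls_X * fls_deriv f" for f :: "rat fls"
  have CCR: "eval3 \<sigma> (- 3 * E4) (- 2 * E6) CCR = 0"
    "is_minimal_poly (generated_field {E4, E6}) \<sigma> (map_poly (eval2 (- 3 * E4) (- 2 * E6)) CCR)"
    "weighted_homogeneous 1 2 3 (l + 1) CCR"
    using assms(3) by (simp_all add: is_CCR_polynomial_def assms(5))
  have U0: "eval3 \<sigma> E4 E6 U = 0"
    using CCR(1) by (simp add: eval3_def assms(4) map_poly_eval2_ccr_subst)
  have nonzero: "d\<sigma> \<noteq> 0"
    using minimal_poly_pderiv_nonzero[OF is_subfield_generated_field CCR(2)]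
    by (simp add: assms(6,4) eval3_partial1 map_poly_eval2_ccr_subst)
  \<comment> \<open>Euler's relation for weights 1, 2, 3; its right-hand side is a multiple of
    U(\<sigma>, E_4, E_6) = 0.\<close>
  have euler: "\<sigma> * d\<sigma> + 2 * E4 * d4 + 3 * E6 * d6 = 0"
    using eval3_euler_weighted_homogeneous[OF weighted_homogeneous_ccr_subst[OF CCR(3)], of \<sigma> E4 E6]
    by (simp add: U0 flip: assms(4,6,7,8))
  have "T (eval3 \<sigma> E4 E6 U) = d\<sigma> * T \<sigma> + d4 * T E4 + d6 * T E6"
    by (simp add: T_def eval3_chain assms(6-8) algebra_simps)
  then have chain: "d\<sigma> * T \<sigma> + d4 * T E4 + d6 * T E6 = 0"
    by (simp add: U0 T_def)
  have sigma: "2 * \<sigma> = L * (L * E2_tilde l - E2)"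
    by (simp add: assms(5) ccr_sigma_def L_def)
  have "2 * T \<sigma> = T (2 * \<sigma>)"
    by (simp add: T_def)
  also have "\<dots> = L * (L * T (E2_tilde l) - T E2)"
    unfolding sigma by (simp add: T_def L_def algebra_simps)
  finally have T_sigma: "2 * T \<sigma> = L * (L * T (E2_tilde l) - T E2)" .
  \<comment> \<open>Insert the equations for \<open>E2_tilde l\<close> and \<open>E2\<close>, then
    replace \<open>L * E2_tilde l\<close> by 2\<sigma>/L + \<open>E2\<close>: the squares of
    \<open>E2\<close> cancel and a term linear in \<open>E2\<close> survives.\<close>
  have "24 * L * T \<sigma> = 4 * \<sigma>\<^sup>2 + 4 * L * E2 * \<sigma> - L ^ 4 * E4_tilde l + L\<^sup>2 * E4"
    using T_sigma sigma theta_E2_tilde[OF l] theta_E2 unfolding T_def L_def[symmetric] by algebra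
  \<comment> \<open>In 24 L times \<open>chain\<close>, the coefficient of \<open>E2\<close> is 4 L
    times the left-hand side of \<open>euler\<close>, hence 0; the remaining terms are the
    claim.\<close>
  then have "L ^ 4 * d\<sigma> * E4_tilde l
      = - (4 * L * (3 * E4\<^sup>2 * d6 + 2 * E6 * d4) - d\<sigma> * (L\<^sup>2 * E4 + 4 * \<sigma>\<^sup>2))"
    using chain euler theta_E4 theta_E6 unfolding T_def by algebra
  then show ?thesis
    using nonzero L0 by (simp add: field_simps flip: L_def)
qed

end
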